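(* There exist graphs with acyclic dimension three that have real acyclic roots of arbitrarily large modulus; that is, for every real $R>0$ there is a graph $G$ with acyclic dimension three and a real root $r$ of $A(G,x)$ with $|r|>R$.
   Context: Graphs are finite, undirected and simple. The acyclic polynomial of a graph $G$ is $A(G,x)=\sum_{i\ge 0} a_i x^i$, where $a_i=|\{S\subseteq V(G): |S|=i \text{ and } G[S] \text{ is acyclic}\}|$ and $G[S]$ is the subgraph of $G$ induced by $S$ (acyclic means containing no cycle; the empty set is acyclic). The acyclic dimension of $G$ is the maximum size of a vertex subset inducing an acyclic subgraph, equivalently the degree of $A(G,x)$. An acyclic root of $G$ is a root of $A(G,x)$. *)

theory Defs
  imports "Graph_Theory.Graph_Theory" "HOL-Computational_Algebra.Polynomial" Complex_Main
begin

text \<open>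
  Finite simple undirected graphs are the symmetric digraphs of locale \<^locale>\<open>graph\<close>:
  an undirected edge \<open>uv\<close> is the pair of arcs \<open>(u, v)\<close> and \<open>(v, u)\<close>.
  A closed walk \<open>u, v, u\<close> along a single edge is therefore a directed cycle of length 2, which
  is not a cycle of the undirected graph. (For this reason the library predicate
  \<^const>\<open>forest\<close> is not suitable: it holds of a symmetric digraph only if it has no arcs.)
  The directed cycles of length at least 3 are exactly the oriented cycles of the undirected graph.
\<close>

definition ugraph_acyclic :: "('a, 'b) pre_digraph \<Rightarrow> bool" where
  "ugraph_acyclic G \<longleftrightarrow> \<not> (\<exists>p. pre_digraph.cycle G p \<and> length p \<ge> 3)"

definition acyclic_sets :: "('a, 'b) pre_digraph \<Rightarrow> 'a set set" where
  "acyclic_sets G = {S. S \<subseteq> verts G \<and> ugraph_acyclic (G \<restriction> S)}"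

definition acyclic_coeff :: "('a, 'b) pre_digraph \<Rightarrow> nat \<Rightarrow> nat" where
  "acyclic_coeff G i = card {S \<in> acyclic_sets G. card S = i}"

definition acyclic_poly :: "('a, 'b) pre_digraph \<Rightarrow> real poly" where
  "acyclic_poly G = (\<Sum>i\<le>card (verts G). monom (real (acyclic_coeff G i)) i)"

definition acyclic_dim :: "('a, 'b) pre_digraph \<Rightarrow> nat" where
  "acyclic_dim G = Max (card ` acyclic_sets G)"

lemma empty_in_acyclic_sets: "{} \<in> acyclic_sets G"
  by (auto simp: acyclic_sets_def ugraph_acyclic_def pre_digraph.cycle_def pre_digraph.awalk_def)

lemma finite_acyclic_sets:
  assumes "graph G"
  shows "finite (acyclic_sets G)"
proof -
  interpret graph G by fact
  show ?thesis
    by (rule finite_subset[of _ "Pow (verts G)"]) (auto simp: acyclic_sets_def)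
qed

lemma coeff_acyclic_poly:
  assumes "graph G"
  shows "coeff (acyclic_poly G) i = real (acyclic_coeff G i)"
proof -
  interpret graph G by fact
  have "acyclic_coeff G i = 0" if "i > card (verts G)"
  proof -
    have "{S \<in> acyclic_sets G. card S = i} = {}"
      using that by (auto simp: acyclic_sets_def dest: card_mono[OF finite_verts])
    then show ?thesis
      unfolding acyclic_coeff_def by (simp only: card.empty)
  qed
  then show ?thesis
    by (auto simp: acyclic_poly_def coeff_sum not_le)
qed

lemma degree_acyclic_poly:
  assumes "graph G"
  shows "degree (acyclic_poly G) = acyclic_dim G"
proof (rule antisym)
  have fin: "finite (card ` acyclic_sets G)"
    using finite_acyclic_sets[OF assms] by simp
  show "degree (acyclic_poly G) \<le> acyclic_dim G"
  proof (rule degree_le, intro allI impI)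
    fix i assume "i > acyclic_dim G"
    then have "{S \<in> acyclic_sets G. card S = i} = {}"
      using Max_ge[OF fin] unfolding acyclic_dim_def by fastforce
    then show "coeff (acyclic_poly G) i = 0"
      unfolding coeff_acyclic_poly[OF assms] acyclic_coeff_def by (simp only: card.empty of_nat_0)
  qed
  have "acyclic_dim G \<in> card ` acyclic_sets G"
    unfolding acyclic_dim_def using fin empty_in_acyclic_sets by (intro Max_in) auto
  then have "acyclic_coeff G (acyclic_dim G) \<noteq> 0"
    using finite_acyclic_sets[OF assms] by (auto simp: acyclic_coeff_def)
  then show "acyclic_dim G \<le> degree (acyclic_poly G)"
    by (intro le_degree) (simp add: coeff_acyclic_poly[OF assms])
qed

end

theory Submission
  imports Defs
begin

text \<open>
  Let \<open>G\<close> be the complete graph on \<open>n \<ge> 3\<close> vertices with a single edge \<open>01\<close> removed. Any three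
  vertices that do not include both \<open>0\<close> and \<open>1\<close> span a triangle, and any four vertices contain such a triple. So
  the acyclic vertex sets are those of size at most two together with the \<open>n - 2\<close> paths
  \<open>{0, 1, k}\<close> (lemma \<open>acyclic_sets_K_minus_edge\<close>), and
  \<open>A(G,x) = 1 + n x + (n choose 2) x\<^sup>2 + (n - 2) x\<^sup>3\<close>.
  The quadratic coefficient grows faster than the cubic one. Hence at any fixed \<open>x < 0\<close> the
  quadratic term wins once \<open>n\<close> is large and \<open>A(G,x) > 0\<close>, whereas at \<open>x = - n\<close> the cubic term has
  taken over and \<open>A(G,x) < 0\<close>. The intermediate value theorem gives a root between \<open>- n\<close> and the
  prescribed negative number.
\<close>

section \<open>Long directed cycles in small digraphs\<close>

lemma ugraph_acyclicD_triangle: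
  assumes "wf_digraph H" "ugraph_acyclic H" "a \<noteq> b" "b \<noteq> c" "c \<noteq> a"
    "(a, b) \<in> arcs_ends H" "(b, c) \<in> arcs_ends H" "(c, a) \<in> arcs_ends H"
  shows False
proof -
  interpret wf_digraph H by fact
  obtain e f g where efg: "e \<in> arcs H" "tail H e = a" "head H e = b"
      "f \<in> arcs H" "tail H f = b" "head H f = c" "g \<in> arcs H" "tail H g = c" "head H g = a"
    using assms(6-8) by (auto simp: arcs_ends_conv)
  then have "awalk a [e, f, g] a"
    using tail_in_verts[of e] by (auto simp: awalk_def)
  then have "cycle [e, f, g]"
    using assms(3-5) efg by (auto simp: cycle_def)
  then show False
    using assms(2) by (auto simp: ugraph_acyclic_def dest: spec[of _ "[e, f, g]"])
qed

text \<open>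
  The heads of the arcs of a cycle are distinct, so a cycle of length at least three on at most
  three vertices visits all of them, and consecutively. Up to direction its arcs therefore join
  all pairs of vertices.
\<close>

lemma not_ugraph_acyclic_card_le_3:
  assumes "fin_digraph H" "card (verts H) \<le> 3" "\<not> ugraph_acyclic H"
  shows "card (verts H) = 3"
    and "\<And>u v. u \<in> verts H \<Longrightarrow> v \<in> verts H \<Longrightarrow> u \<noteq> v
           \<Longrightarrow> (u, v) \<in> arcs_ends H \<or> (v, u) \<in> arcs_ends H"
proof -
  interpret fin_digraph H by fact
  obtain p u where p: "awalk u p u" "distinct (tl (awalk_verts u p))" "length p \<ge> 3"
    using assms(3) by (auto simp: ugraph_acyclic_def cycle_def)
  have cas: "cas u p u" and arcs: "set p \<subseteq> arcs H"
    using p(1) by (auto simp: awalk_def)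
  have heads: "tl (awalk_verts u p) = map (head H) p"
    using awalk_verts_conv'[OF cas] p(3) by auto
  have sub: "set (map (head H) p) \<subseteq> verts H"
    using arcs by auto
  have "length p = card (set (map (head H) p))"
    using p(2) distinct_card[of "map (head H) p"] by (simp add: heads)
  also have "\<dots> \<le> card (verts H)"
    using sub by (intro card_mono) auto
  finally have len: "length p = 3" and card: "card (verts H) = 3"
    using p(3) assms(2) by auto
  show "card (verts H) = 3" by fact
  have V: "set (map (head H) p) = verts H"
    using p(2) distinct_card[of "map (head H) p"] card len sub
    by (intro card_subset_eq) (auto simp: heads)
  obtain e f g where efg: "p = [e, f, g]"
    using len by (auto simp: numeral_3_eq_3 length_Suc_conv)
  have arcs': "(head H g, head H e) \<in> arcs_ends H" "(head H e, head H f) \<in> arcs_ends H"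
      "(head H f, head H g) \<in> arcs_ends H"
    using cas arcs in_arcs_imp_in_arcs_ends[of e] in_arcs_imp_in_arcs_ends[of f]
      in_arcs_imp_in_arcs_ends[of g] by (auto simp: efg)
  fix x y assume "x \<in> verts H" "y \<in> verts H" "x \<noteq> y"
  then have "x \<in> {head H e, head H f, head H g}" "y \<in> {head H e, head H f, head H g}"
    by (simp_all add: V[symmetric] efg)
  then show "(x, y) \<in> arcs_ends H \<or> (y, x) \<in> arcs_ends H"
    using \<open>x \<noteq> y\<close> arcs' by (elim insertE emptyE) simp_all
qed

section \<open>The complete graph minus one edge\<close>

definition K_minus_edge :: "nat \<Rightarrow> (nat, nat \<times> nat) pre_digraph" where
  "K_minus_edge n =
     \<lparr>verts = {..<n}, arcs = {(a, b). a < n \<and> b < n \<and> a \<noteq> b \<and> {a, b} \<noteq> {0, 1}},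
      tail = fst, head = snd\<rparr>"

lemma verts_K_minus_edge [simp]: "verts (K_minus_edge n) = {..<n}"
  by (simp add: K_minus_edge_def)

lemma graph_K_minus_edge: "graph (K_minus_edge n)"
proof -
  have "finite (arcs (K_minus_edge n))"
    by (rule finite_subset[of _ "{..<n} \<times> {..<n}"]) (auto simp: K_minus_edge_def)
  then show ?thesis
    by unfold_locales
      (auto simp: K_minus_edge_def arc_to_ends_def symmetric_conv insert_commute)
qed

lemma arcs_ends_induce_K_minus_edge:
  assumes "S \<subseteq> {..<n}"
  shows "(a, b) \<in> arcs_ends (K_minus_edge n \<restriction> S)
           \<longleftrightarrow> a \<in> S \<and> b \<in> S \<and> a \<noteq> b \<and> {a, b} \<noteq> {0, 1}"
proof -
  let ?A = "{e \<in> arcs (K_minus_edge n). fst e \<in> S \<and> snd e \<in> S}"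
  have "arcs_ends (K_minus_edge n \<restriction> S) = ?A"
    by (simp add: arcs_ends_def arc_to_ends_def induce_subgraph_def K_minus_edge_def)
  then show ?thesis
    using assms by (auto simp: K_minus_edge_def doubleton_eq_iff)
qed

text \<open>
  A set that is not listed here contains three vertices not including both \<open>0\<close> and \<open>1\<close>, hence a
  triangle. Conversely, a cycle inside a listed set would need three vertices and would have to
  use the missing edge.
\<close>

lemma acyclic_sets_K_minus_edge:
  "acyclic_sets (K_minus_edge n)
     = {S. S \<subseteq> {..<n} \<and> (card S \<le> 2 \<or> card S = 3 \<and> {0, 1} \<subseteq> S)}"
proof -
  interpret graph "K_minus_edge n" by (rule graph_K_minus_edge)
  have "ugraph_acyclic (K_minus_edge n \<restriction> S) \<longleftrightarrow> card S \<le> 2 \<or> card S = 3 \<and> {0, 1} \<subseteq> S"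
    (is "?acyclic \<longleftrightarrow> ?small") if S: "S \<subseteq> {..<n}" for S
  proof
    have fin: "finite S"
      using S finite_subset by blast
    assume acyc: ?acyclic
    show ?small
    proof (rule ccontr)
      assume not_small: "\<not> ?small"
      \<comment> \<open>If both ends of the missing edge lie in \<open>S\<close>, there are four vertices, so one end can be
        given up.\<close>
      define U where "U = (if {0, 1} \<subseteq> S then S - {0} else S)"
      have "card U \<ge> 3"
        using not_small fin by (auto simp: U_def)
      then obtain T where T: "T \<subseteq> U" "card T = 3"
        by (meson obtain_subset_with_card_n)
      then obtain a b c where abc: "T = {a, b, c}" "a \<noteq> b" "b \<noteq> c" "c \<noteq> a"
        by (auto simp: card_3_iff)
      have "T \<subseteq> S" "\<not> {0, 1} \<subseteq> T"
        using T(1) by (auto simp: U_def split: if_splits)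
      then have "(a, b) \<in> arcs_ends (K_minus_edge n \<restriction> S)"
          "(b, c) \<in> arcs_ends (K_minus_edge n \<restriction> S)" "(c, a) \<in> arcs_ends (K_minus_edge n \<restriction> S)"
        using abc by (auto simp: arcs_ends_induce_K_minus_edge[OF S] doubleton_eq_iff)
      then show False
        using ugraph_acyclicD_triangle[OF wellformed_induce_subgraph acyc abc(2-4)] by auto
    qed
  next
    assume small: ?small
    have fin: "fin_digraph (K_minus_edge n \<restriction> S)"
      using finite_subset[OF S]
      by (intro wf_digraph.fin_digraphI wellformed_induce_subgraph) auto
    show ?acyclic
    proof (rule ccontr)
      assume "\<not> ?acyclic"
      note cycle = not_ugraph_acyclic_card_le_3[OF fin _ this]
      have "card S = 3"
        using cycle(1) small by auto
      have adj: "(u, v) \<in> arcs_ends (K_minus_edge n \<restriction> S) \<or> (v, u) \<in> arcs_ends (K_minus_edge n \<restriction> S)"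
        if "u \<in> S" "v \<in> S" "u \<noteq> v" for u v
        using cycle(2)[of u v] \<open>card S = 3\<close> that by simp
      show False
        using adj[of 0 1] small \<open>card S = 3\<close> by (auto simp: arcs_ends_induce_K_minus_edge[OF S])
    qed
  qed
  then show ?thesis
    by (auto simp: acyclic_sets_def)
qed

lemma acyclic_dim_K_minus_edge:
  assumes "n \<ge> 3"
  shows "acyclic_dim (K_minus_edge n) = 3"
  unfolding acyclic_dim_def
proof (rule Max_eqI)
  show "finite (card ` acyclic_sets (K_minus_edge n))"
    using finite_acyclic_sets[OF graph_K_minus_edge] by simp
  show "k \<le> 3" if "k \<in> card ` acyclic_sets (K_minus_edge n)" for k
    using that by (auto simp: acyclic_sets_K_minus_edge)
  have "{0, 1, 2} \<in> acyclic_sets (K_minus_edge n)"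
    using assms by (auto simp: acyclic_sets_K_minus_edge)
  then show "3 \<in> card ` acyclic_sets (K_minus_edge n)"
    by (rule rev_image_eqI) simp
qed

lemma acyclic_coeff_K_minus_edge_le_2:
  assumes "i \<le> 2"
  shows "acyclic_coeff (K_minus_edge n) i = n choose i"
proof -
  have "{S \<in> acyclic_sets (K_minus_edge n). card S = i} = {S. S \<subseteq> {..<n} \<and> card S = i}"
    using assms by (auto simp: acyclic_sets_K_minus_edge)
  then show ?thesis
    by (simp add: acyclic_coeff_def n_subsets)
qed

lemma acyclic_coeff_K_minus_edge_3:
  "acyclic_coeff (K_minus_edge n) 3 = n - 2"
proof -
  have "{S \<in> acyclic_sets (K_minus_edge n). card S = 3} = (\<lambda>k. {0, 1, k}) ` {2..<n}" (is "?L = ?R")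
  proof (intro equalityI subsetI)
    fix S assume S: "S \<in> ?L"
    then have "{0, 1} \<subseteq> S" "card S = 3" "S \<subseteq> {..<n}"
      by (auto simp: acyclic_sets_K_minus_edge)
    then have "card (S - {0, 1}) = 1"
      by (subst card_Diff_subset) auto
    then obtain k where k: "S - {0, 1} = {k}"
      by (auto simp: card_1_singleton_iff)
    have "S = {0, 1, k}"
      using \<open>{0, 1} \<subseteq> S\<close> k by blast
    moreover have "k \<in> S - {0, 1}"
      unfolding k by simp
    then have "k \<in> {2..<n}"
      using \<open>S \<subseteq> {..<n}\<close> by (simp add: subset_eq)
    ultimately show "S \<in> ?R"
      by (rule image_eqI)
  qed (auto simp: acyclic_sets_K_minus_edge)
  moreover have "inj_on (\<lambda>k. {0, 1, k}) {2..<n}"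
    by (rule inj_onI) (auto simp: insert_eq_iff doubleton_eq_iff)
  ultimately show ?thesis
    by (simp add: acyclic_coeff_def card_image)
qed

lemma poly_acyclic_poly_K_minus_edge:
  assumes "n \<ge> 3"
  shows "poly (acyclic_poly (K_minus_edge n)) x
           = 1 + real n * x + real n * (real n - 1) / 2 * x ^ 2 + (real n - 2) * x ^ 3"
proof -
  have "{..3::nat} = {0, 1, 2, 3}"
    by auto
  moreover have "real (n choose 2) = real n * (real n - 1) / 2"
    using assms by (simp add: choose_two real_of_nat_div of_nat_diff)
  ultimately show ?thesis
    using assms
    by (simp add: poly_altdef degree_acyclic_poly[OF graph_K_minus_edge] acyclic_dim_K_minus_edge
        coeff_acyclic_poly[OF graph_K_minus_edge] acyclic_coeff_K_minus_edge_le_2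
        acyclic_coeff_K_minus_edge_3 of_nat_diff)
qed

section \<open>Roots of large modulus\<close>

theorem theorem2p13:
  fixes R :: real
  assumes "R > 0"
  shows "\<exists>(G :: (nat, nat \<times> nat) pre_digraph) (r :: real).
           graph G \<and> acyclic_dim G = 3 \<and> poly (acyclic_poly G) r = 0 \<and> \<bar>r\<bar> > R"
proof -
  define M where "M = max R 1"
  have M: "M \<ge> 1" "M \<ge> R"
    by (auto simp: M_def)
  obtain n :: nat where n: "real n \<ge> 2 * M + 5"
    using real_arch_simple by blast
  then have n3: "n \<ge> 3"
    using M by linarith
  let ?p = "acyclic_poly (K_minus_edge n)"
  \<comment> \<open>At \<open>- M\<close> the bound \<open>(n - 1) / 2 \<ge> M + 2\<close> makes the quadratic term at least
    \<open>n M\<^sup>3 + 2 n M\<^sup>2\<close>; this covers the cubic and the linear term.\<close>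
  have "(real n - 1) / 2 * (real n * M ^ 2) \<ge> (M + 2) * (real n * M ^ 2)"
    using n by (intro mult_right_mono) auto
  moreover have "real n * M ^ 2 \<ge> real n * M"
    using M by (intro mult_left_mono) (auto simp: power2_eq_square)
  moreover have "M ^ 3 > 0" "real n * M ^ 2 \<ge> 0"
    using M by simp_all
  ultimately have pos: "poly ?p (- M) > 0"
    by (simp add: poly_acyclic_poly_K_minus_edge[OF n3] field_simps
        power2_eq_square power3_eq_cube)
  have "1 \<le> real n ^ 2"
    using n3 by simp
  moreover have "real n ^ 3 * 3 \<le> real n ^ 3 * real n"
    using n3 by (intro mult_left_mono) auto
  ultimately have neg: "poly ?p (- real n) \<le> 0"
    by (simp add: poly_acyclic_poly_K_minus_edge[OF n3] field_simps
        power2_eq_square power3_eq_cube)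
  have "\<exists>r. - real n \<le> r \<and> r \<le> - M \<and> poly ?p r = 0"
    using pos neg n M by (intro IVT') (auto intro!: continuous_intros)
  then obtain r where r: "r \<le> - M" "poly ?p r = 0"
    by blast
  with pos have "r \<noteq> - M"
    by auto
  with r M have "\<bar>r\<bar> > R"
    by linarith
  with r(2) graph_K_minus_edge acyclic_dim_K_minus_edge[OF n3] show ?thesis
    by blast
qed

end
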